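(* If $G$ is an alternating group $A_n$ or a symmetric group $\Sigma_n$, then $\mathcal{N}_G=0$.
   Context: For a finite group $G$, two elements $g,h\in G$ are $\mathbb{R}$-$\mathrm{Aut}(G)$-conjugate if $g$ is in the $\mathrm{Aut}(G)$-orbit of $h$ or of $h^{-1}$; they are $\mathbb{Q}$-$\mathrm{Aut}(G)$-conjugate if the cyclic subgroups $\langle g\rangle$ and $\langle h\rangle$ are in the same $\mathrm{Aut}(G)$-orbit. Define $$\mathcal{N}_G = \#\{\mathbb{R}\text{-}\mathrm{Aut}(G)\text{-conjugacy classes in } G\} - \#\{\mathbb{Q}\text{-}\mathrm{Aut}(G)\text{-conjugacy classes in } G\}.$$ *)

theory Defs
  imports "HOL-Algebra.Sym_Groups" "HOL-Algebra.Bij" "HOL-Algebra.Group_Action"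
begin

definition real_aut_conj :: "('a, 'b) monoid_scheme \<Rightarrow> ('a \<times> 'a) set"
  where "real_aut_conj G = {(g, h). g \<in> carrier G \<and> h \<in> carrier G \<and>
    (g \<in> Group_Action.orbit (AutoGroup G) (\<lambda>\<phi>. \<phi>) h \<or>
     g \<in> Group_Action.orbit (AutoGroup G) (\<lambda>\<phi>. \<phi>) (inv\<^bsub>G\<^esub> h))}"

definition rat_aut_conj :: "('a, 'b) monoid_scheme \<Rightarrow> ('a \<times> 'a) set"
  where "rat_aut_conj G = {(g, h). g \<in> carrier G \<and> h \<in> carrier G \<and>
    generate G {g} \<in> Group_Action.orbit (AutoGroup G) (\<lambda>\<phi> H. \<phi> ` H) (generate G {h})}"

text \<open>
  The invariant is meant for finite groups, where both cardinalities are genuine. The difference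
  is taken in the integers to avoid truncated subtraction.
\<close>

definition N_inv :: "('a, 'b) monoid_scheme \<Rightarrow> int"
  where "N_inv G = int (card (carrier G // real_aut_conj G)) - int (card (carrier G // rat_aut_conj G))"

lemma mem_orbit_AutoGroup:
  "y \<in> Group_Action.orbit (AutoGroup G) f x \<longleftrightarrow> (\<exists>\<phi>\<in>auto G. y = f \<phi> x)"
  by (auto simp: orbit_def AutoGroup_def)

lemma (in group) auto_inverse:
  assumes "\<phi> \<in> auto G"
  obtains \<psi> where "\<psi> \<in> auto G" "\<And>x. x \<in> carrier G \<Longrightarrow> \<psi> (\<phi> x) = x"
proof
  have b: "bij_betw \<phi> (carrier G) (carrier G)" and h: "\<phi> \<in> hom G G" "\<phi> \<in> Bij (carrier G)"
    using assms by (auto simp: auto_def Bij_def)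
  show "restrict (inv_into (carrier G) \<phi>) (carrier G) \<in> auto G"
    using h restrict_inv_into_hom restrict_inv_into_Bij by (auto simp: auto_def)
  show "restrict (inv_into (carrier G) \<phi>) (carrier G) (\<phi> x) = x" if "x \<in> carrier G" for x
    using b that by (auto simp: bij_betw_def)
qed

lemma (in group) auto_compose:
  assumes "\<phi> \<in> auto G" "\<psi> \<in> auto G"
  shows "compose (carrier G) \<phi> \<psi> \<in> auto G"
  using assms hom_compose[of \<psi> G \<phi> G] compose_Bij[of \<phi> "carrier G" \<psi>]
  by (auto simp: auto_def)

lemma (in group) auto_closed: "\<phi> \<in> auto G \<Longrightarrow> x \<in> carrier G \<Longrightarrow> \<phi> x \<in> carrier G"
  by (auto simp: auto_def hom_def)

lemma (in group) auto_inv: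
  assumes "\<phi> \<in> auto G" "x \<in> carrier G"
  shows "\<phi> (inv x) = inv (\<phi> x)"
proof -
  have "group_hom G G \<phi>"
    using assms by (unfold_locales) (auto simp: auto_def)
  then show ?thesis using assms by (simp add: group_hom.hom_inv)
qed

lemma (in group) equiv_real_aut_conj: "equiv (carrier G) (real_aut_conj G)"
proof -
  have eq: "real_aut_conj G = {(g, h). g \<in> carrier G \<and> h \<in> carrier G \<and>
      (\<exists>\<phi>\<in>auto G. g = \<phi> h \<or> g = inv (\<phi> h))}"
    unfolding real_aut_conj_def mem_orbit_AutoGroup
    by (simp add: auto_inv bex_disj_distrib cong: conj_cong bex_cong)
  show ?thesis
  proof (rule equivI)
    show "real_aut_conj G \<subseteq> carrier G \<times> carrier G" by (auto simp: eq)
    show "refl_on (carrier G) (real_aut_conj G)"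
      using id_in_auto by (intro refl_onI) (auto simp: eq intro!: bexI[of _ "\<lambda>x\<in>carrier G. x"])
    show "sym (real_aut_conj G)"
    proof (rule symI)
      fix g h assume "(g, h) \<in> real_aut_conj G"
      then obtain \<phi> where p: "\<phi> \<in> auto G" "g \<in> carrier G" "h \<in> carrier G" "g = \<phi> h \<or> g = inv (\<phi> h)"
        unfolding eq by blast
      obtain \<psi> where q: "\<psi> \<in> auto G" "\<And>x. x \<in> carrier G \<Longrightarrow> \<psi> (\<phi> x) = x"
        using auto_inverse[OF p(1)] by blast
      have "h = \<psi> g \<or> h = inv (\<psi> g)"
        using p(3,4) q(2)[OF p(3)] auto_inv[OF q(1) auto_closed[OF p(1) p(3)]] inv_inv by metis
      then show "(h, g) \<in> real_aut_conj G" unfolding eq using p(2,3) q(1) by blast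
    qed
    show "trans (real_aut_conj G)"
    proof (rule transI)
      fix g h k assume "(g, h) \<in> real_aut_conj G" "(h, k) \<in> real_aut_conj G"
      then obtain \<phi> \<psi> where p: "\<phi> \<in> auto G" "\<psi> \<in> auto G"
        "g \<in> carrier G" "h \<in> carrier G" "k \<in> carrier G"
        "g = \<phi> h \<or> g = inv (\<phi> h)" "h = \<psi> k \<or> h = inv (\<psi> k)"
        unfolding eq by blast
      let ?c = "compose (carrier G) \<phi> \<psi>"
      have "?c k = \<phi> (\<psi> k)" using p by (simp add: compose_def)
      then have "g = ?c k \<or> g = inv (?c k)"
        using p(6,7) auto_inv[OF p(1) auto_closed[OF p(2) p(5)]]
          inv_inv[OF auto_closed[OF p(1) auto_closed[OF p(2) p(5)]]] by metis
      then show "(g, k) \<in> real_aut_conj G"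
        unfolding eq using p(3,5) auto_compose[OF p(1,2)] by blast
    qed
  qed
qed

lemma (in group) equiv_rat_aut_conj: "equiv (carrier G) (rat_aut_conj G)"
proof -
  have sub: "generate G {x} \<subseteq> carrier G" if "x \<in> carrier G" for x
    using that generate_incl by simp
  show ?thesis
  proof (rule equivI)
    show "rat_aut_conj G \<subseteq> carrier G \<times> carrier G" by (auto simp: rat_aut_conj_def)
    have "generate G {x} = (\<lambda>x\<in>carrier G. x) ` generate G {x}" if "x \<in> carrier G" for x
      using sub[OF that] by force
    then show "refl_on (carrier G) (rat_aut_conj G)"
      using id_in_auto unfolding rat_aut_conj_def mem_orbit_AutoGroup by (intro refl_onI) blast
    show "sym (rat_aut_conj G)"
    proof (rule symI)
      fix g h assume "(g, h) \<in> rat_aut_conj G"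
      then obtain \<phi> where p: "\<phi> \<in> auto G" "g \<in> carrier G" "h \<in> carrier G"
          "generate G {g} = \<phi> ` generate G {h}"
        by (auto simp: rat_aut_conj_def mem_orbit_AutoGroup)
      obtain \<psi> where q: "\<psi> \<in> auto G" "\<And>x. x \<in> carrier G \<Longrightarrow> \<psi> (\<phi> x) = x"
        using auto_inverse[OF p(1)] by blast
      have "\<psi> ` \<phi> ` generate G {h} = (\<lambda>x. x) ` generate G {h}"
        unfolding image_image using q(2) sub[OF p(3)] by (intro image_cong) auto
      then have "generate G {h} = \<psi> ` generate G {g}" by (simp add: p(4))
      then show "(h, g) \<in> rat_aut_conj G"
        using p q by (auto simp: rat_aut_conj_def mem_orbit_AutoGroup)
    qed
    show "trans (rat_aut_conj G)"
    proof (rule transI)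
      fix g h k assume "(g, h) \<in> rat_aut_conj G" "(h, k) \<in> rat_aut_conj G"
      then obtain \<phi> \<psi> where p: "\<phi> \<in> auto G" "\<psi> \<in> auto G" "g \<in> carrier G" "k \<in> carrier G"
          "generate G {g} = \<phi> ` generate G {h}" "generate G {h} = \<psi> ` generate G {k}"
        by (auto simp: rat_aut_conj_def mem_orbit_AutoGroup)
      have "generate G {g} = compose (carrier G) \<phi> \<psi> ` generate G {k}"
        unfolding p(5,6) image_image using sub[OF p(4)]
        by (intro image_cong) (auto simp: compose_def)
      then show "(g, k) \<in> rat_aut_conj G"
        using p auto_compose[OF p(1,2)] by (auto simp: rat_aut_conj_def mem_orbit_AutoGroup)
    qed
  qed
qed

end

theory Submission
  imports Defs "HOL-Algebra.Multiplicative_Group" "HOL-Combinatorics.Orbits"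
begin

text \<open>
  Two generators of the same cyclic group of permutations have the same orbits and the same period
  at each point, so they are conjugate in the symmetric group. Conjugation by any permutation
  restricts to an automorphism of the alternating group, so both \<open>\<rat>\<close>-classes and \<open>\<real>\<close>-classes
  coincide with the automorphism classes.
\<close>

text \<open>Iterates of \<open>f\<close> commute, so a coincidence at \<open>x\<close> persists
  along its forward orbit; induction on \<open>k\<close> then yields
  \<open>(f ^^ (k * i)) x = (f ^^ (k * j)) x\<close>.\<close>

lemma funpow_power_agree:
  fixes f :: "'a \<Rightarrow> 'a"
  assumes "(f ^^ i) x = (f ^^ j) x"
  shows "((f ^^ k) ^^ i) x = ((f ^^ k) ^^ j) x"
proof -
  have "(f ^^ (k * i)) x = (f ^^ (k * j)) x"
  proof (induction k)
    case (Suc k)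
    have "(f ^^ (Suc k * i)) x = (f ^^ i) ((f ^^ (k * j)) x)"
      using Suc by (simp add: funpow_add)
    also have "\<dots> = (f ^^ (k * j)) ((f ^^ i) x)"
      by (metis add.commute comp_apply funpow_add)
    also have "\<dots> = (f ^^ (Suc k * j)) x"
      using assms by (metis add.commute comp_apply funpow_add mult_Suc)
    finally show ?case .
  qed simp
  then show ?thesis by (simp add: funpow_mult mult.commute)
qed

text \<open>Pick a base point \<open>b\<close> in each orbit of \<open>p\<close> and send
  \<open>(p ^^ i) b\<close> to \<open>(q ^^ i) b\<close>. This is well defined and injective because
  each permutation is a power of the other, so both have the same period at
  \<open>b\<close>.\<close>

lemma permutes_mutual_powers_conjugate:
  fixes p q :: "'a \<Rightarrow> 'a"
  assumes S: "finite S" "p permutes S" and q: "q = p ^^ k" and p: "p = q ^^ m"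
  obtains s where "s permutes S" "s \<circ> p \<circ> inv' s = q"
proof -
  \<comment> \<open>The choice depends only on the orbit as a set, so \<open>r\<close> is constant
    on orbits. The exponent \<open>ix x\<close> is arbitrary, not the least one.\<close>
  define r where "r x = (SOME y. y \<in> Orbits.orbit p x)" for x
  define ix where "ix x = (SOME i. (p ^^ i) (r x) = x)" for x
  define s where "s x = (q ^^ ix x) (r x)" for x
  have perm: "permutation p" using S permutation_permutes by blast
  note self = permutation_self_in_orbit[OF perm]
  have r: "r x \<in> Orbits.orbit p x" for x
    unfolding r_def using someI[of "\<lambda>y. y \<in> Orbits.orbit p x"] self by blast
  have r_eq: "r y = r x" if "y \<in> Orbits.orbit p x" for x y
    using that by (simp add: r_def orbit_cyclic_eq3[OF cyclic_on_orbit'[OF perm]])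
  have x_r: "x \<in> Orbits.orbit p (r x)" for x
    using r self orbit_swap by fast
  have ix: "(p ^^ ix x) (r x) = x" for x
  proof -
    have "\<exists>i. (p ^^ i) (r x) = x"
      using x_r[of x] unfolding orbit_altdef_permutation[OF perm]
      by (elim CollectE exE conjE) (rule exI, erule sym)
    then show ?thesis unfolding ix_def by (rule someI_ex)
  qed
  have agree: "(q ^^ i) x = (q ^^ j) x \<longleftrightarrow> (p ^^ i) x = (p ^^ j) x" for i j x
    using funpow_power_agree[of i p x j k] funpow_power_agree[of i q x j m] p q by metis
  have s_orbit: "s x \<in> Orbits.orbit p x" for x
    using funpow_in_orbit[OF r, of "k * ix x"] by (simp add: s_def q funpow_mult)
  have inj: "inj s"
  proof (rule injI)
    fix x y assume eq: "s x = s y"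
    then have "r x = r y" using s_orbit[of x] s_orbit[of y] r_eq by metis
    then have "(p ^^ ix x) (r x) = (p ^^ ix y) (r x)" using eq agree by (simp add: s_def)
    then show "x = y" using ix \<open>r x = r y\<close> by metis
  qed
  \<comment> \<open>Orbits of points of \<open>S\<close> stay in \<open>S\<close>, while a point
    outside \<open>S\<close> is its own orbit and hence fixed by \<open>s\<close>.\<close>
  have "s ` S \<subseteq> S" using s_orbit permutes_orbit_subset[OF S(2)] by blast
  moreover have "s x = x" if "x \<notin> S" for x
    using that s_orbit[of x] orbit_eq_singleton_iff[of p x] permutes_not_in[OF S(2)] by blast
  moreover have "inj_on s S" using inj by (rule inj_on_subset) simp
  ultimately have s: "s permutes S"
    using endo_inj_surj[OF S(1)] by (intro bij_imp_permutes) (auto simp: bij_betw_def)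
  have comm: "s (p x) = q (s x)" for x
  proof -
    have "r (p x) = r x" by (rule r_eq) (rule orbit.base)
    \<comment> \<open>The exponents \<open>ix (p x)\<close> and \<open>Suc (ix x)\<close> may
      differ, but both reach \<open>p x\<close> from the base point, so \<open>agree\<close> lets
      one replace the other under \<open>q\<close>.\<close>
    then have "(p ^^ ix (p x)) (r x) = (p ^^ Suc (ix x)) (r x)" using ix[of x] ix[of "p x"] by simp
    then have "(q ^^ ix (p x)) (r x) = (q ^^ Suc (ix x)) (r x)" by (simp only: agree)
    then show ?thesis by (simp add: s_def \<open>r (p x) = r x\<close>)
  qed
  have "s \<circ> p \<circ> inv' s = q"
    by (simp add: fun_eq_iff comm permutes_inverses(1)[OF s])
  with s that show ?thesis by blast
qed

lemma (in group) generate_auto: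
  assumes "\<phi> \<in> auto G" "x \<in> carrier G"
  shows "generate G {\<phi> x} = \<phi> ` generate G {x}"
proof -
  interpret group_hom G G \<phi>
    using assms by unfold_locales (auto simp: auto_def)
  show ?thesis using generate_img[of "{x}"] assms by simp
qed

lemma (in group) generate_singleton_inv:
  assumes "x \<in> carrier G"
  shows "generate G {inv x} = generate G {x}"
proof -
  have "generate G {inv y} \<subseteq> generate G {y}" if "y \<in> carrier G" for y
    using that by (intro generate_subgroup_incl generate_is_subgroup)
      (auto intro: generate.inv)
  from this[of x] this[of "inv x"] assms show ?thesis by auto
qed

text \<open>If \<open>\<phi>\<close> carries the subgroup of \<open>h\<close> onto that of
  \<open>g\<close>, then \<open>g\<close> and \<open>\<phi> h\<close> generate the same subgroup,
  and the hypothesis supplies a second automorphism taking \<open>\<phi> h\<close> to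
  \<open>g\<close>. Hence the two relations coincide.\<close>

lemma (in group) N_inv_eq_0_if_generators_auto_conj:
  assumes conj: "\<And>g h. g \<in> carrier G \<Longrightarrow> h \<in> carrier G \<Longrightarrow> generate G {g} = generate G {h}
      \<Longrightarrow> \<exists>\<phi>\<in>auto G. g = \<phi> h"
  shows "N_inv G = 0"
proof -
  have "(g, h) \<in> real_aut_conj G \<longleftrightarrow> (g, h) \<in> rat_aut_conj G" for g h
  proof
    assume "(g, h) \<in> real_aut_conj G"
    then obtain \<phi> where p: "g \<in> carrier G" "h \<in> carrier G" "\<phi> \<in> auto G" "g = \<phi> h \<or> g = \<phi> (inv h)"
      by (auto simp: real_aut_conj_def mem_orbit_AutoGroup)
    then have "generate G {g} = \<phi> ` generate G {h}"
      using generate_auto[OF p(3)] generate_singleton_inv[OF p(2)] inv_closed by metis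
    with p show "(g, h) \<in> rat_aut_conj G"
      by (auto simp: rat_aut_conj_def mem_orbit_AutoGroup)
  next
    assume "(g, h) \<in> rat_aut_conj G"
    then obtain \<phi> where p: "g \<in> carrier G" "h \<in> carrier G" "\<phi> \<in> auto G"
        "generate G {g} = \<phi> ` generate G {h}"
      by (auto simp: rat_aut_conj_def mem_orbit_AutoGroup)
    then obtain \<psi> where q: "\<psi> \<in> auto G" "g = \<psi> (\<phi> h)"
      using conj[OF p(1) auto_closed[OF p(3,2)]] generate_auto by metis
    then have "g = compose (carrier G) \<psi> \<phi> h" using p by (simp add: compose_def)
    then show "(g, h) \<in> real_aut_conj G"
      using p auto_compose[OF q(1) p(3)] by (auto simp: real_aut_conj_def mem_orbit_AutoGroup)
  qed
  then have "real_aut_conj G = rat_aut_conj G" by auto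
  then show ?thesis by (simp add: N_inv_def)
qed

text \<open>Here \<open>s\<close> may lie outside \<open>G\<close>, which lets odd permutations act
  on the alternating group. The restriction makes the map extensional, as \<open>Bij\<close>
  demands.\<close>

lemma conjugation_in_auto:
  fixes G :: "('a \<Rightarrow> 'a) monoid"
  assumes "monoid G" and mult: "mult G = (\<circ>)" and s: "bij s"
    and closed: "\<And>x. x \<in> carrier G \<Longrightarrow> s \<circ> x \<circ> inv' s \<in> carrier G"
      "\<And>x. x \<in> carrier G \<Longrightarrow> inv' s \<circ> x \<circ> s \<in> carrier G"
  shows "(\<lambda>x\<in>carrier G. s \<circ> x \<circ> inv' s) \<in> auto G"
proof -
  have c: "inv' s (s x) = x" "s (inv' s x) = x" for x
    using s by (simp_all add: bij_is_inj bij_is_surj surj_f_inv_f)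
  have "bij_betw (\<lambda>x. s \<circ> x \<circ> inv' s) (carrier G) (carrier G)"
    using closed by (intro bij_betw_byWitness[where f' = "\<lambda>x. inv' s \<circ> x \<circ> s"])
      (auto simp: c fun_eq_iff)
  then have "(\<lambda>x\<in>carrier G. s \<circ> x \<circ> inv' s) \<in> Bij (carrier G)"
    by (simp add: Bij_def bij_betw_restrict_eq)
  moreover have "x \<circ> y \<in> carrier G" if "x \<in> carrier G" "y \<in> carrier G" for x y
    using monoid.m_closed[OF \<open>monoid G\<close> that] by (simp add: mult)
  then have "(\<lambda>x\<in>carrier G. s \<circ> x \<circ> inv' s) \<in> hom G G"
    using closed(1) by (intro homI) (simp_all add: mult c fun_eq_iff)
  ultimately show ?thesis by (simp add: auto_def)
qed

theorem mainTheorem6: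
  fixes n :: nat and G :: "(nat \<Rightarrow> nat) monoid"
  assumes "G = alt_group n \<or> G = sym_group n"
  shows "N_inv G = 0"
proof -
  interpret group G using assms sym_group_is_group alt_group_is_group by auto
  have ops: "mult G = (\<circ>)" "one G = id"
    using assms by (auto simp: alt_group_mult sym_group_mult alt_group_one sym_group_one)
  have sub: "x permutes {1..n}" if "x \<in> carrier G" for x
    using that assms by (auto simp: alt_group_carrier sym_group_carrier)
  \<comment> \<open>Equal parities of \<open>s\<close> and \<open>t\<close> cancel, so
    \<open>s \<circ> x \<circ> t\<close> has the parity of \<open>x\<close>. Two independent letters
    cover conjugation by a permutation and by its inverse at once.\<close>
  have conj_closed: "s \<circ> x \<circ> t \<in> carrier G"
    if "x \<in> carrier G" "s permutes {1..n}" "t permutes {1..n}" "evenperm s = evenperm t" for s t x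
  proof -
    have "permutation s" "permutation t" "permutation x"
      using that sub permutation_permutes by blast+
    then show ?thesis
      using that assms
      by (auto simp: alt_group_carrier sym_group_carrier evenperm_comp permutation_compose
          intro!: permutes_compose)
  qed
  have "finite (carrier G)"
    by (rule finite_subset[OF _ finite_permutations[of "{1..n}"]]) (auto dest: sub)
  \<comment> \<open>Finiteness makes natural exponents suffice for a cyclic subgroup, so its
    elements are iterates under \<open>^^\<close>.\<close>
  note gen = generate_pow_on_finite_carrier[OF this]
  have pow: "x [^]\<^bsub>G\<^esub> k = x ^^ k" for x and k :: nat
    by (induction k) (simp_all add: ops funpow_Suc_right del: funpow.simps(2))
  show ?thesis
  proof (rule N_inv_eq_0_if_generators_auto_conj)
    fix g h assume gh: "g \<in> carrier G" "h \<in> carrier G" "generate G {g} = generate G {h}"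
    have "g \<in> generate G {h}" "h \<in> generate G {g}"
      using gh(3) generate.incl[of g "{g}" G] generate.incl[of h "{h}" G] by simp_all
    then obtain k m where "g = h ^^ k" "h = g ^^ m"
      unfolding gen[OF gh(1)] gen[OF gh(2)] pow by (elim CollectE exE conjE)
    then obtain s where s: "s permutes {1..n}" "s \<circ> h \<circ> inv' s = g"
      using permutes_mutual_powers_conjugate[OF _ sub[OF gh(2)]] by blast
    have "evenperm (inv' s) = evenperm s"
      using s(1) permutation_permutes by (intro evenperm_inv) blast
    then have "(\<lambda>x\<in>carrier G. s \<circ> x \<circ> inv' s) \<in> auto G"
      using s(1) permutes_inv[OF s(1)]
      by (intro conjugation_in_auto is_monoid ops conj_closed) (auto intro: permutes_bij)
    then show "\<exists>\<phi>\<in>auto G. g = \<phi> h"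
      by (rule bexI[rotated]) (simp add: gh(2) s(2))
  qed
qed

end
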